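(* For every integer $n \ge 2$, \[ \chi_2(n) \le \left\lfloor \frac{2n}{3} \right\rfloor + 1 . \]
   Context: For a prime power $q$ and integer $n\ge 1$, $\mathrm{PG}(n-1,q)$ is the projective space whose points are the $1$-dimensional subspaces of $\mathbb{F}_q^n$ and whose lines are the $2$-dimensional subspaces of $\mathbb{F}_q^n$. $\chi_q(n)$ denotes the minimum number of colors needed to color the points of $\mathrm{PG}(n-1,q)$ so that no line is monochromatic (all its points receiving the same color). For $q=2$, points are the nonzero vectors of $\mathbb{F}_2^n$ and lines are the triples $\{x,y,x+y\}$ with $x\ne y$ nonzero. *)

theory Defs
  imports Complex_Main "HOL-Library.Function_Algebras" "HOL-Library.Z2"
begin

instance bit :: finite
proof
  have "(UNIV :: bit set) = {0, 1}"
    using bit_not_one_iff by blast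
  then show "finite (UNIV :: bit set)"
    by (metis finite.emptyI finite.insertI)
qed

text \<open>
  Sequences over a field form a vector space under pointwise operations; the space
  of dimension \<open>n\<close> is realised inside it as the sequences vanishing from index \<open>n\<close> on, so
  that \<open>n\<close> can be an ordinary natural number and the library's subspaces and dimension apply.
\<close>

definition seq_scale :: "'a::field \<Rightarrow> (nat \<Rightarrow> 'a) \<Rightarrow> nat \<Rightarrow> 'a"
  where "seq_scale c v = (\<lambda>i. c * v i)"

global_interpretation seq: vector_space "seq_scale :: 'a::field \<Rightarrow> (nat \<Rightarrow> 'a) \<Rightarrow> nat \<Rightarrow> 'a"
  by standard (auto simp: seq_scale_def fun_eq_iff algebra_simps)

definition coord_space :: "nat \<Rightarrow> (nat \<Rightarrow> 'a::field) set"
  where "coord_space n = {v. \<forall>i\<ge>n. v i = 0}"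

text \<open>Points and lines of \<open>PG(n-1, q)\<close>, where \<open>q\<close> is the cardinality of the field \<open>'a\<close>.\<close>

definition pg_points :: "nat \<Rightarrow> (nat \<Rightarrow> 'a::{field,finite}) set set"
  where "pg_points n = {P. seq.subspace P \<and> P \<subseteq> coord_space n \<and> seq.dim P = 1}"

definition pg_lines :: "nat \<Rightarrow> (nat \<Rightarrow> 'a::{field,finite}) set set"
  where "pg_lines n = {L. seq.subspace L \<and> L \<subseteq> coord_space n \<and> seq.dim L = 2}"

definition monochromatic ::
    "nat \<Rightarrow> ((nat \<Rightarrow> 'a::{field,finite}) set \<Rightarrow> nat) \<Rightarrow> (nat \<Rightarrow> 'a) set \<Rightarrow> bool"
  where "monochromatic n c L \<longleftrightarrow> (\<exists>j. \<forall>P\<in>pg_points n. P \<subseteq> L \<longrightarrow> c P = j)"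

definition pg_colorable :: "'a::{field,finite} itself \<Rightarrow> nat \<Rightarrow> nat \<Rightarrow> bool"
  where "pg_colorable TYPE('a) n k \<longleftrightarrow>
    (\<exists>c :: (nat \<Rightarrow> 'a) set \<Rightarrow> nat.
       (\<forall>P\<in>pg_points n. c P < k) \<and> (\<forall>L\<in>pg_lines n. \<not> monochromatic n c L))"

text \<open>
  The minimum exists: there are finitely many points and every line contains at least two of them,
  so giving all points distinct colours is always admissible.
\<close>

definition chi :: "'a::{field,finite} itself \<Rightarrow> nat \<Rightarrow> nat"
  where "chi TYPE('a) n = (LEAST k. pg_colorable TYPE('a) n k)"

end

theory Submission
  imports Defs
begin

text \<open>
  Over the two-element field a proper colouring is a partition of the nonzero vectors into sum-free
  classes. Colouring by the first nonzero coordinate handles \<open>n \<le> 3\<close>, and three further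
  dimensions cost only two new colours. For the latter, the fibres over the points of the Fano plane
  outside a line are half old and half new: the new halves are cut out by the first coordinate, and
  an old half reuses the colouring \<open>c\<close> through a translation into the affine hyperplane
  \<open>x 0 = 1\<close>, which avoids \<open>0\<close> and preserves differences.
\<close>

section \<open>Reduction to colourings of nonzero vectors\<close>

definition sum_free_coloring :: "nat \<Rightarrow> nat \<Rightarrow> ((nat \<Rightarrow> bit) \<Rightarrow> nat) \<Rightarrow> bool"
  where "sum_free_coloring n k c \<longleftrightarrow>
    (\<forall>v\<in>coord_space n - {0}. c v < k) \<and>
    (\<forall>x\<in>coord_space n - {0}. \<forall>y\<in>coord_space n - {0}. \<forall>z\<in>coord_space n - {0}.
       x + y + z = 0 \<longrightarrow> c x = c y \<longrightarrow> c y = c z \<longrightarrow> False)"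

lemma bit_add_eq_0_iff: "a + b = 0 \<longleftrightarrow> a = b" for a b :: bit
  by (cases a; cases b) auto

lemma bit_vec_add_eq_0_iff: "v + w = 0 \<longleftrightarrow> v = w" for v w :: "nat \<Rightarrow> bit"
  unfolding fun_eq_iff plus_fun_apply zero_fun_apply bit_add_eq_0_iff ..

lemma bit_vec_span_singleton: "seq.span {v} = {0, v}" for v :: "nat \<Rightarrow> bit"
proof -
  have "seq_scale b v \<in> {0, v}" for b
    by (cases b) (auto simp: seq_scale_def fun_eq_iff)
  moreover have "0 = seq_scale 0 v" "v = seq_scale 1 v"
    by (auto simp: seq_scale_def fun_eq_iff)
  ultimately show ?thesis
    unfolding seq.span_singleton by blast
qed

lemma bit_pg_point_iff:
  "P \<in> pg_points n \<longleftrightarrow> (\<exists>v\<in>coord_space n - {0}. P = {0, v})" for P :: "(nat \<Rightarrow> bit) set"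
proof
  assume "P \<in> pg_points n"
  then have P: "seq.subspace P" "P \<subseteq> coord_space n" "seq.dim P = 1"
    by (auto simp: pg_points_def)
  obtain B where B: "B \<subseteq> P" "seq.independent B" "P \<subseteq> seq.span B" "card B = seq.dim P"
    using seq.basis_exists by blast
  then obtain v where v: "B = {v}"
    using P by (metis card_1_singletonE)
  with B have "v \<noteq> 0"
    using seq.dependent_zero by blast
  moreover have "P = {0, v}"
    using B v P seq.subspace_0 bit_vec_span_singleton[of v] by auto
  ultimately show "\<exists>v\<in>coord_space n - {0}. P = {0, v}"
    using P by auto
next
  assume "\<exists>v\<in>coord_space n - {0}. P = {0, v}"
  then obtain v where v: "v \<in> coord_space n" "v \<noteq> 0" "P = seq.span {v}"
    unfolding bit_vec_span_singleton by blast
  then have "seq.dim P = 1"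
    using seq.dim_span_eq_card_independent[of "{v}"] by simp
  moreover have "P \<subseteq> coord_space n"
    using v by (auto simp: bit_vec_span_singleton coord_space_def)
  ultimately show "P \<in> pg_points n"
    using v by (simp add: pg_points_def seq.subspace_span)
qed

text \<open>Two basis vectors and their sum: in characteristic 2 only equal vectors add up to 0. One
  such triple per line is enough to refute a single colour.\<close>

lemma bit_pg_line_contains_triple:
  fixes L :: "(nat \<Rightarrow> bit) set"
  assumes "L \<in> pg_lines n"
  obtains x y where "x \<in> L" "y \<in> L" "x + y \<in> L" "x \<noteq> 0" "y \<noteq> 0" "x + y \<noteq> 0"
proof -
  have L: "seq.subspace L" "seq.dim L = 2"
    using assms by (auto simp: pg_lines_def)
  obtain B where B: "B \<subseteq> L" "seq.independent B" "card B = seq.dim L"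
    using seq.basis_exists by metis
  then obtain x y where "B = {x, y}" "x \<noteq> y"
    using L by (metis card_2_iff)
  moreover have "0 \<notin> B"
    using B seq.dependent_zero by blast
  moreover have "x + y \<in> L" if "x \<in> L" "y \<in> L" for x y
    using L that seq.subspace_add by blast
  ultimately show ?thesis
    using that[of x y] B by (auto simp: bit_vec_add_eq_0_iff)
qed

text \<open>In characteristic 2 the triples \<open>x, y, x + y\<close> are the zero-sum triples of
  nonzero vectors, a form symmetric in the three and with distinctness built in.\<close>

lemma sum_free_coloring_imp_pg_colorable:
  assumes "sum_free_coloring n k c"
  shows "pg_colorable TYPE(bit) n k"
proof -
  \<comment> \<open>A point over \<open>bit\<close> is \<open>{0, v}\<close>, so \<open>THE\<close>
    picks its only nonzero vector.\<close>
  define C where "C P = c (THE v. v \<in> P \<and> v \<noteq> 0)" for P :: "(nat \<Rightarrow> bit) set"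
  have C: "C {0, v} = c v" if "v \<noteq> 0" for v
  proof -
    have "(THE w. w \<in> {0, v} \<and> w \<noteq> 0) = v"
      using that by (intro the_equality) auto
    then show ?thesis
      by (simp add: C_def)
  qed
  have "C P < k" if "P \<in> pg_points n" for P
  proof -
    obtain v where "v \<in> coord_space n - {0}" "P = {0, v}"
      using \<open>P \<in> pg_points n\<close> by (auto simp: bit_pg_point_iff)
    then show ?thesis
      using assms C[of v] by (simp add: sum_free_coloring_def)
  qed
  moreover have False if L: "L \<in> pg_lines n" and mono: "monochromatic n C L" for L
  proof -
    obtain x y where xy: "x \<in> L" "y \<in> L" "x + y \<in> L" "x \<noteq> 0" "y \<noteq> 0" "x + y \<noteq> 0"
      using bit_pg_line_contains_triple[OF L] by blast
    obtain j where j: "\<forall>P\<in>pg_points n. P \<subseteq> L \<longrightarrow> C P = j"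
      using mono by (auto simp: monochromatic_def)
    have sub: "L \<subseteq> coord_space n" "0 \<in> L"
      using L seq.subspace_0 by (auto simp: pg_lines_def)
    have "c v = j" if "v \<in> L" "v \<noteq> 0" for v
    proof -
      have "{0, v} \<in> pg_points n"
        using that sub by (auto simp: bit_pg_point_iff)
      then show ?thesis
        using j C that sub by (metis empty_subsetI insert_subset)
    qed
    then have "c x = j" "c y = j" "c (x + y) = j"
      using xy by blast+
    moreover have "x + y + (x + y) = 0"
      unfolding bit_vec_add_eq_0_iff ..
    moreover have "x \<in> coord_space n - {0}" "y \<in> coord_space n - {0}"
        "x + y \<in> coord_space n - {0}"
      using xy sub by blast+
    ultimately show False
      using assms unfolding sum_free_coloring_def by metis
  qed
  ultimately show ?thesis
    unfolding pg_colorable_def by blast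
qed

section \<open>Sum-free classes: leading index and the two new classes\<close>

lemma sum_free_coloring_first_nonzero:
  "sum_free_coloring n n (\<lambda>v. LEAST i. v i \<noteq> 0)"
proof -
  have nz: "v (LEAST i. v i \<noteq> 0) = 1" if "v \<noteq> 0" for v :: "nat \<Rightarrow> bit"
    using that LeastI_ex[of "\<lambda>i. v i \<noteq> 0"] by (auto simp: fun_eq_iff)
  have "(LEAST i. v i \<noteq> 0) < n" if "v \<in> coord_space n - {0}" for v :: "nat \<Rightarrow> bit"
    using that nz[of v] by (force simp: coord_space_def not_le[symmetric])
  moreover have False
    if "x \<noteq> 0" "y \<noteq> 0" "z \<noteq> 0" "x + y + z = 0"
      and "(LEAST i. x i \<noteq> 0) = (LEAST i. y i \<noteq> 0)" "(LEAST i. y i \<noteq> 0) = (LEAST i. z i \<noteq> 0)"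
    for x y z :: "nat \<Rightarrow> bit"
  proof -
    let ?j = "LEAST i. z i \<noteq> 0"
    \<comment> \<open>The entries at the common leading index add up to 1 + 1 + 1 = 1, not
      0.\<close>
    have "x ?j = 1" "y ?j = 1" "z ?j = 1"
      using that nz[of x] nz[of y] nz[of z] by simp_all
    moreover have "(x + y + z) ?j = 0"
      using that by simp
    ultimately show False
      by simp
  qed
  ultimately show ?thesis
    unfolding sum_free_coloring_def by blast
qed

text \<open>
  The new classes, as predicates of the three added coordinates \<open>a, b, d\<close> and the first coordinate
  \<open>f\<close>. The fibres over \<open>(0,1,0)\<close> and \<open>(0,0,1)\<close> are entirely new, the one over \<open>(0,1,1)\<close> is
  split between both classes.
\<close>

definition new_class1 :: "bit \<Rightarrow> bit \<Rightarrow> bit \<Rightarrow> bit \<Rightarrow> bool"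
  where "new_class1 a b d f \<longleftrightarrow>
    (if a = 0 then b = 1 \<and> (d = 0 \<or> f = 1) else b = d \<and> f = 1)"

definition new_class2 :: "bit \<Rightarrow> bit \<Rightarrow> bit \<Rightarrow> bit \<Rightarrow> bool"
  where "new_class2 a b d f \<longleftrightarrow>
    (if a = 0 then d = 1 \<and> (b = 0 \<or> f = 0) else b \<noteq> d \<and> f = b)"

text \<open>A zero-sum triple contains none or two vectors with \<open>a = 1\<close>. If none,
  \<open>b = 1\<close> throughout contradicts 1 + 1 + 1 = 1; if two, the third has
  \<open>b = d\<close> and \<open>f = 0\<close>, which the class excludes for
  \<open>a = 0\<close>.\<close>

lemma new_class1_sum_free:
  assumes "new_class1 a b d f" "new_class1 a' b' d' f'"
  shows "\<not> new_class1 (a + a') (b + b') (d + d') (f + f')"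
  using assms unfolding new_class1_def
  by (cases a; cases b; cases d; cases f; cases a'; cases b'; cases d'; cases f') simp_all

text \<open>As for the first class, with \<open>d = 1\<close> throughout if no vector has
  \<open>a = 1\<close>. If two have it, the third has \<open>b = d = f\<close>, while membership
  with \<open>a = 0\<close> needs \<open>d = 1\<close> together with \<open>b = 0\<close> or
  \<open>f = 0\<close>.\<close>

lemma new_class2_sum_free:
  assumes "new_class2 a b d f" "new_class2 a' b' d' f'"
  shows "\<not> new_class2 (a + a') (b + b') (d + d') (f + f')"
  using assms unfolding new_class2_def
  by (cases a; cases b; cases d; cases f; cases a'; cases b'; cases d'; cases f') simp_all

section \<open>Old vectors and their reduction to the smaller space\<close>

abbreviation "new1 n v \<equiv> new_class1 (v n) (v (n + 1)) (v (n + 2)) (v 0)"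
abbreviation "new2 n v \<equiv> new_class2 (v n) (v (n + 1)) (v (n + 2)) (v 0)"

text \<open>On an old half with \<open>v n = 1\<close> the coordinate \<open>v 0\<close> is
  constant, so overwriting it by 1 is a translation there.\<close>

definition base_part :: "nat \<Rightarrow> (nat \<Rightarrow> bit) \<Rightarrow> nat \<Rightarrow> bit"
  where "base_part n v =
    (\<lambda>i. if i = 0 \<and> v n = 1 then 1 else if i < n then v i else 0)"

definition extend_coloring :: "nat \<Rightarrow> nat \<Rightarrow> ((nat \<Rightarrow> bit) \<Rightarrow> nat) \<Rightarrow> (nat \<Rightarrow> bit) \<Rightarrow> nat"
  where "extend_coloring n k c v =
    (if new1 n v then k else if new2 n v then k + 1 else c (base_part n v))"

text \<open>All fibres over the line \<open>a = 0\<close> are new, so an old vector with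
  \<open>a = 0\<close> already lies in the original space.\<close>

lemma not_new_classes_base:
  assumes "\<not> new_class1 0 b d f" "\<not> new_class2 0 b d f"
  shows "b = 0" "d = 0"
  using assms unfolding new_class1_def new_class2_def by (cases b; cases d; cases f; simp)+

text \<open>Outside that line the old half is a single value of \<open>f\<close>: 0 if
  \<open>b = d\<close>, and \<open>b + 1\<close> otherwise.\<close>

lemma not_new_classes_fibre:
  assumes "\<not> new_class1 1 b d f" "\<not> new_class2 1 b d f"
    and "\<not> new_class1 1 b d f'" "\<not> new_class2 1 b d f'"
  shows "f = f'"
  using assms unfolding new_class1_def new_class2_def by (cases b; cases d; cases f; cases f'; simp)

lemma base_part_nonzero:
  assumes v: "v \<in> coord_space (n + 3) - {0}" and "\<not> new1 n v" "\<not> new2 n v" "n \<ge> 1"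
  shows "base_part n v \<in> coord_space n - {0}"
proof (cases "v n")
  case zero
  \<comment> \<open>With all three added coordinates zero, \<open>base_part n v\<close> is
    \<open>v\<close> itself.\<close>
  then have z: "v (n + 1) = 0" "v (n + 2) = 0"
    using not_new_classes_base assms by metis+
  obtain i where i: "v i \<noteq> 0"
    using v by (auto simp: fun_eq_iff)
  have "i < n"
  proof (rule ccontr)
    assume "\<not> i < n"
    then have "i = n \<or> i = n + 1 \<or> i = n + 2 \<or> i \<ge> n + 3"
      by auto
    then show False
      using i zero z v unfolding coord_space_def by auto
  qed
  then have "base_part n v i \<noteq> 0"
    using i zero by (simp add: base_part_def)
  then have "base_part n v \<noteq> 0"
    by auto
  then show ?thesis
    using zero by (simp add: base_part_def coord_space_def)
next
  case one
  then have "base_part n v 0 \<noteq> 0"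
    by (simp add: base_part_def)
  then have "base_part n v \<noteq> 0"
    by auto
  \<comment> \<open>Coordinate 0 must lie below \<open>n\<close> for the overwritten vector to stay
    in \<open>coord_space n\<close>.\<close>
  then show ?thesis
    using \<open>n \<ge> 1\<close> by (simp add: base_part_def coord_space_def)
qed

text \<open>\<open>base_part\<close> is not additive in general, but in a zero-sum triple coordinate
  0 is overwritten in none or exactly two of the vectors.\<close>

lemma base_part_add:
  assumes "\<not> new1 n x" "\<not> new2 n x" "\<not> new1 n y" "\<not> new2 n y"
    and "\<not> new1 n z" "\<not> new2 n z" and sum: "x + y + z = 0"
  shows "base_part n x + base_part n y + base_part n z = 0"
proof -
  have s: "x i + y i + z i = 0" for i
    using sum by (metis plus_fun_apply zero_fun_apply)
  \<comment> \<open>Up to permutation the only case with overwriting: \<open>z\<close> has zero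
    added coordinates, so \<open>x\<close> and \<open>y\<close> lie in the same old half and agree
    at 0; hence \<open>z 0 = 0\<close>, matching 1 + 1.\<close>
  have *: "base_part n x + base_part n y + base_part n z = 0"
    if one: "x n = 1" "y n = 1" and "z n = 0" and "x + y + z = 0"
      and x: "\<not> new1 n x" "\<not> new2 n x" and y: "\<not> new1 n y" "\<not> new2 n y"
      and z: "\<not> new1 n z" "\<not> new2 n z"
    for x y z :: "nat \<Rightarrow> bit"
  proof -
    have s: "x i + y i + z i = 0" for i
      using that by (metis plus_fun_apply zero_fun_apply)
    have "z (n + 1) = 0" "z (n + 2) = 0"
      using not_new_classes_base z \<open>z n = 0\<close> by metis+
    then have eq: "x (n + 1) = y (n + 1)" "x (n + 2) = y (n + 2)"
      using s[of "n + 1"] s[of "n + 2"] bit_add_eq_0_iff by simp_all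
    have "x 0 = y 0"
      by (rule not_new_classes_fibre[of "y (n + 1)" "y (n + 2)"])
        (use x y one in \<open>unfold eq, simp_all\<close>)
    then have "z 0 = 0"
      using s[of 0] by simp
    then show ?thesis
      using s that by (auto simp: base_part_def fun_eq_iff)
  qed
  have "x n + y n + z n = 0"
    by (rule s)
  then consider "x n = 0" "y n = 0" "z n = 0" | "x n = 1" "y n = 1" "z n = 0"
    | "x n = 1" "y n = 0" "z n = 1" | "x n = 0" "y n = 1" "z n = 1"
    by (cases "x n"; cases "y n"; cases "z n") auto
  then show ?thesis
  proof cases
    case 1
    then show ?thesis
      using s by (auto simp: base_part_def fun_eq_iff)
  next
    case 2
    then show ?thesis
      using * assms by blast
  next
    case 3
    then show ?thesis
      using *[of x z y] assms by (simp add: ac_simps)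
  next
    case 4
    then show ?thesis
      using *[of y z x] assms by (simp add: ac_simps)
  qed
qed

section \<open>Assembly and induction in steps of three dimensions\<close>

lemma sum_free_coloring_extend:
  assumes c: "sum_free_coloring n k c" and "n \<ge> 1"
  shows "sum_free_coloring (n + 3) (k + 2) (extend_coloring n k c)"
proof -
  let ?e = "extend_coloring n k c"
  have bound: "c (base_part n v) < k"
    if "v \<in> coord_space (n + 3) - {0}" "\<not> new1 n v" "\<not> new2 n v" for v
    using base_part_nonzero[OF that \<open>n \<ge> 1\<close>] c unfolding sum_free_coloring_def by blast
  have lt: "?e v < k + 2" if "v \<in> coord_space (n + 3) - {0}" for v
    using bound[OF that] by (auto simp: extend_coloring_def)
  \<comment> \<open>Old colours stay below \<open>k\<close>, so \<open>k\<close> and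
    \<open>k + 1\<close> single out the new classes.\<close>
  have e1: "?e v = k \<longleftrightarrow> new1 n v" if "v \<in> coord_space (n + 3) - {0}" for v
    using bound[OF that] by (auto simp: extend_coloring_def)
  have e2: "?e v = k + 1 \<longleftrightarrow> \<not> new1 n v \<and> new2 n v" if "v \<in> coord_space (n + 3) - {0}" for v
    using bound[OF that] by (auto simp: extend_coloring_def)
  have False
    if x: "x \<in> coord_space (n + 3) - {0}" and y: "y \<in> coord_space (n + 3) - {0}"
      and z: "z \<in> coord_space (n + 3) - {0}"
      and sum: "x + y + z = 0" and col: "?e x = ?e y" "?e y = ?e z" for x y z
  proof -
    have zi: "z i = x i + y i" for i
      using sum bit_vec_add_eq_0_iff[of "x + y" z] by (metis plus_fun_apply)
    consider "?e z = k" | "?e z = k + 1" | "?e z \<noteq> k" "?e z \<noteq> k + 1"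
      by blast
    then show False
    proof cases
      case 1
      then have "new1 n x" "new1 n y" "new1 n z"
        using e1 x y z col by simp_all
      then show False
        using new_class1_sum_free unfolding zi by blast
    next
      case 2
      then have "new2 n x" "new2 n y" "new2 n z"
        using e2 x y z col by simp_all
      then show False
        using new_class2_sum_free unfolding zi by blast
    next
      case 3
      then have old: "\<not> new1 n x" "\<not> new2 n x" "\<not> new1 n y" "\<not> new2 n y"
        "\<not> new1 n z" "\<not> new2 n z"
        using e1 e2 x y z col by metis+
      then have "c (base_part n x) = c (base_part n y)" "c (base_part n y) = c (base_part n z)"
        using col by (simp_all add: extend_coloring_def)
      then show False
        using c base_part_add[OF old sum] base_part_nonzero x y z old \<open>n \<ge> 1\<close>
        unfolding sum_free_coloring_def by blast
    qed
  qed
  then show ?thesis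
    using lt unfolding sum_free_coloring_def by blast
qed

text \<open>The bound grows by 2 when \<open>n\<close> grows by 3. The range starts at 1 because
  dimension 4 descends to 1.\<close>

lemma sum_free_coloring_exists:
  assumes "n \<ge> 1"
  shows "\<exists>c. sum_free_coloring n (2 * n div 3 + 1) c"
  using assms
proof (induction n rule: less_induct)
  case (less n)
  show ?case
  proof (cases "n \<le> 3")
    case True
    then have "n = 1 \<or> n = 2 \<or> n = 3"
      using less.prems by auto
    \<comment> \<open>The bound equals \<open>n\<close> exactly for these three values, so the
      leading-index colouring fits.\<close>
    then have "2 * n div 3 + 1 = n"
      by auto
    then show ?thesis
      using sum_free_coloring_first_nonzero by metis
  next
    case False
    define m where "m = n - 3"
    then have m: "n = m + 3" "m \<ge> 1"
      using False by simp_all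
    then obtain c where "sum_free_coloring m (2 * m div 3 + 1) c"
      using less.IH[of m] by auto
    moreover have "2 * n div 3 + 1 = 2 * m div 3 + 1 + 2"
      using m by simp
    ultimately show ?thesis
      using sum_free_coloring_extend m by metis
  qed
qed

theorem theorem1p1:
  fixes n :: nat
  assumes "n \<ge> 2"
  shows "int (chi TYPE(bit) n) \<le> \<lfloor>2 * real n / 3\<rfloor> + 1"
proof -
  obtain c where "sum_free_coloring n (2 * n div 3 + 1) c"
    using sum_free_coloring_exists[of n] assms by auto
  then have "chi TYPE(bit) n \<le> 2 * n div 3 + 1"
    unfolding chi_def by (intro Least_le sum_free_coloring_imp_pg_colorable)
  moreover have "\<lfloor>2 * real n / 3\<rfloor> = int (2 * n div 3)"
    using floor_divide_of_nat_eq[of "2 * n" 3, where ?'a = real] by simp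
  ultimately show ?thesis
    by linarith
qed

end
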